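(* For every $M\in\mathbb{H}^{n\times n}$, $\mathrm{Sdet}[M]=\prod_{i=1}^{n}\sigma_i$, where $\sigma_1\ge\sigma_2\ge\dots\ge\sigma_n\ge 0$ are the singular values of $M$.
   Context: $\mathbb{H}$ is the skew-field of real quaternions $q=a+ib+jc+kd$ with $a,b,c,d\in\mathbb{R}$, $i^2=j^2=k^2=ijk=-1$, and conjugation $\bar q=a-ib-jc-kd$. The adjoint of $M\in\mathbb{H}^{n\times n}$ is $(M^{+})_{ij}=\overline{M_{ji}}$, and $U\in\mathbb{H}^{n\times n}$ is unitary if $U^{+}U=I$. Every $M\in\mathbb{H}^{n\times n}$ has a singular value decomposition $M=U\Sigma V$ with $U,V\in\mathbb{H}^{n\times n}$ unitary and $\Sigma=\mathrm{diag}(\sigma_1,\dots,\sigma_n)$ real with $\sigma_1\ge\dots\ge\sigma_n\ge 0$; the $\sigma_i$ (including zeros) are the singular values of $M$. Every $M\in\mathbb{H}^{n\times n}$ is uniquely written $M=M_1+jM_2$ with $M_1,M_2\in\mathbb{C}^{n\times n}$ (where $\mathbb{C}=\mathbb{R}+i\mathbb{R}\subset\mathbb{H}$), and its complexification is the complex $2n\times 2n$ matrix $\mathcal{Z}[M]=\begin{pmatrix} M_1 & -M_2^*\\ M_2 & M_1^*\end{pmatrix}$, where $*$ is entrywise complex conjugation. The determinant $\det\mathcal{Z}[M]$ (the $q$-determinant) is real and nonnegative, and the Study determinant is normalized by $\mathrm{Sdet}[M]=\left(\det \mathcal{Z}[M]\right)^{1/2}\ge 0$. *)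

theory Defs
  imports Complex_Main "Jordan_Normal_Form.Determinant"
begin

section \<open>The skew field of real quaternions\<close>

codatatype quat = Quat (qRe: real) (qI: real) (qJ: real) (qK: real)

lemma quat_eqI:
  "\<lbrakk>qRe x = qRe y; qI x = qI y; qJ x = qJ y; qK x = qK y\<rbrakk> \<Longrightarrow> x = y"
  by (rule quat.expand) simp

lemma quat_eq_iff: "x = y \<longleftrightarrow> qRe x = qRe y \<and> qI x = qI y \<and> qJ x = qJ y \<and> qK x = qK y"
  by (auto intro: quat_eqI)

instantiation quat :: ab_group_add
begin

primcorec zero_quat where
  "qRe 0 = 0" | "qI 0 = 0" | "qJ 0 = 0" | "qK 0 = 0"

primcorec plus_quat where
  "qRe (x + y) = qRe x + qRe y"
| "qI (x + y) = qI x + qI y"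
| "qJ (x + y) = qJ x + qJ y"
| "qK (x + y) = qK x + qK y"

primcorec uminus_quat where
  "qRe (- x) = - qRe x"
| "qI (- x) = - qI x"
| "qJ (- x) = - qJ x"
| "qK (- x) = - qK x"

primcorec minus_quat where
  "qRe (x - y) = qRe x - qRe y"
| "qI (x - y) = qI x - qI y"
| "qJ (x - y) = qJ x - qJ y"
| "qK (x - y) = qK x - qK y"

instance by standard (simp_all add: quat_eq_iff)

end

lemma quat_norm_sq_eq_0_iff:
  "(qRe x)\<^sup>2 + (qI x)\<^sup>2 + (qJ x)\<^sup>2 + (qK x)\<^sup>2 = 0 \<longleftrightarrow> x = 0"
  by (auto simp: quat_eq_iff add_nonneg_eq_0_iff)

instantiation quat :: real_div_algebra
begin

primcorec one_quat where
  "qRe 1 = 1" | "qI 1 = 0" | "qJ 1 = 0" | "qK 1 = 0"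

primcorec times_quat where
  "qRe (x * y) = qRe x * qRe y - qI x * qI y - qJ x * qJ y - qK x * qK y"
| "qI (x * y) = qRe x * qI y + qI x * qRe y + qJ x * qK y - qK x * qJ y"
| "qJ (x * y) = qRe x * qJ y - qI x * qK y + qJ x * qRe y + qK x * qI y"
| "qK (x * y) = qRe x * qK y + qI x * qJ y - qJ x * qI y + qK x * qRe y"

primcorec scaleR_quat where
  "qRe (scaleR r x) = r * qRe x"
| "qI (scaleR r x) = r * qI x"
| "qJ (scaleR r x) = r * qJ x"
| "qK (scaleR r x) = r * qK x"

primcorec inverse_quat where
  "qRe (inverse x) = qRe x / ((qRe x)\<^sup>2 + (qI x)\<^sup>2 + (qJ x)\<^sup>2 + (qK x)\<^sup>2)"
| "qI (inverse x) = - qI x / ((qRe x)\<^sup>2 + (qI x)\<^sup>2 + (qJ x)\<^sup>2 + (qK x)\<^sup>2)"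
| "qJ (inverse x) = - qJ x / ((qRe x)\<^sup>2 + (qI x)\<^sup>2 + (qJ x)\<^sup>2 + (qK x)\<^sup>2)"
| "qK (inverse x) = - qK x / ((qRe x)\<^sup>2 + (qI x)\<^sup>2 + (qJ x)\<^sup>2 + (qK x)\<^sup>2)"

definition "x div y = x * inverse y" for x y :: quat

instance
proof
  fix x :: quat
  assume "x \<noteq> 0"
  then have "(qRe x)\<^sup>2 + (qI x)\<^sup>2 + (qJ x)\<^sup>2 + (qK x)\<^sup>2 \<noteq> 0"
    by (simp add: quat_norm_sq_eq_0_iff)
  then show "inverse x * x = 1" and "x * inverse x = 1"
    by (auto simp add: quat_eq_iff add_divide_distrib[symmetric] diff_divide_distrib[symmetric]
        power2_eq_square algebra_simps)
qed (simp_all add: quat_eq_iff divide_quat_def algebra_simps)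

end

definition quat_i :: quat where "quat_i = Quat 0 1 0 0"
definition quat_j :: quat where "quat_j = Quat 0 0 1 0"
definition quat_k :: quat where "quat_k = Quat 0 0 0 1"

lemma quat_units:
  "quat_i * quat_i = -1" "quat_j * quat_j = -1" "quat_k * quat_k = -1"
  "quat_i * quat_j * quat_k = -1"
  by (simp_all add: quat_eq_iff quat_i_def quat_j_def quat_k_def)

lemma of_real_quat: "of_real r = Quat r 0 0 0"
  by (simp add: of_real_def quat_eq_iff)

lemma quat_expansion:
  "Quat a b c d = of_real a + quat_i * of_real b + quat_j * of_real c + quat_k * of_real d"
  by (simp add: quat_eq_iff of_real_quat quat_i_def quat_j_def quat_k_def)

definition qcnj :: "quat \<Rightarrow> quat" where
  "qcnj q = Quat (qRe q) (- qI q) (- qJ q) (- qK q)"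


section \<open>Quaternionic matrices and their singular values\<close>

definition qadjoint :: "quat mat \<Rightarrow> quat mat" where
  "qadjoint M = mat (dim_col M) (dim_row M) (\<lambda>(i, j). qcnj (M $$ (j, i)))"

definition qunitary :: "nat \<Rightarrow> quat mat \<Rightarrow> bool" where
  "qunitary n U \<longleftrightarrow> U \<in> carrier_mat n n \<and> qadjoint U * U = 1\<^sub>m n"

definition real_diag_mat :: "nat \<Rightarrow> (nat \<Rightarrow> real) \<Rightarrow> quat mat" where
  "real_diag_mat n \<sigma> = mat n n (\<lambda>(i, j). if i = j then of_real (\<sigma> i) else 0)"

text \<open>
  The singular values \<open>\<sigma>\<^sub>1 \<ge> \<dots> \<ge> \<sigma>\<^sub>n\<close> are indexed from zero, as \<open>\<sigma> 0, \<dots>, \<sigma> (n - 1)\<close>;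
  values of \<open>\<sigma>\<close> at indices \<open>\<ge> n\<close> are irrelevant.
\<close>

definition is_singular_values :: "nat \<Rightarrow> quat mat \<Rightarrow> (nat \<Rightarrow> real) \<Rightarrow> bool" where
  "is_singular_values n M \<sigma> \<longleftrightarrow>
     (\<forall>i j. i \<le> j \<and> j < n \<longrightarrow> \<sigma> j \<le> \<sigma> i) \<and> (\<forall>i<n. 0 \<le> \<sigma> i) \<and>
     (\<exists>U V. qunitary n U \<and> qunitary n V \<and> M = U * real_diag_mat n \<sigma> * V)"


section \<open>Complexification and the Study determinant\<close>

definition quat_of_complex :: "complex \<Rightarrow> quat" where
  "quat_of_complex z = Quat (Re z) (Im z) 0 0"

text \<open>
  The components of \<open>q = z\<^sub>1 + j z\<^sub>2\<close> with \<open>z\<^sub>1, z\<^sub>2\<close> complex. The sign in the second one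
  comes from \<open>j i = - k\<close>.
\<close>

definition qcomp1 :: "quat \<Rightarrow> complex" where "qcomp1 q = Complex (qRe q) (qI q)"
definition qcomp2 :: "quat \<Rightarrow> complex" where "qcomp2 q = Complex (qJ q) (- qK q)"

lemma quat_complex_decomp:
  "q = quat_of_complex z\<^sub>1 + quat_j * quat_of_complex z\<^sub>2 \<longleftrightarrow> z\<^sub>1 = qcomp1 q \<and> z\<^sub>2 = qcomp2 q"
  by (auto simp: quat_eq_iff complex_eq_iff quat_of_complex_def quat_j_def qcomp1_def qcomp2_def)

definition complexification :: "quat mat \<Rightarrow> complex mat" where
  "complexification M =
     (let M\<^sub>1 = map_mat qcomp1 M; M\<^sub>2 = map_mat qcomp2 M
      in four_block_mat M\<^sub>1 (- map_mat cnj M\<^sub>2) M\<^sub>2 (map_mat cnj M\<^sub>1))"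

lemma det_complexification_real:
  assumes M: "M \<in> carrier_mat n n"
  shows "det (complexification M) \<in> \<real>"
proof -
  interpret cnj: comm_ring_hom cnj
    by unfold_locales auto
  define A where "A = map_mat qcomp1 M"
  define B where "B = map_mat qcomp2 M"
  define A' where "A' = map_mat cnj A"
  define B' where "B' = map_mat cnj B"
  have c: "A \<in> carrier_mat n n" "B \<in> carrier_mat n n" "A' \<in> carrier_mat n n" "B' \<in> carrier_mat n n"
    using M by (auto simp: A_def B_def A'_def B'_def)
  let ?Z = "four_block_mat A (- B') B A'"
  let ?W = "four_block_mat A' (- B) B' A"
  let ?J = "four_block_mat (0\<^sub>m n n) (- 1\<^sub>m n) (1\<^sub>m n) (0\<^sub>m n n) :: complex mat"
  let ?K = "four_block_mat (0\<^sub>m n n) (1\<^sub>m n) (- 1\<^sub>m n) (0\<^sub>m n n) :: complex mat"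
  have Z: "complexification M = ?Z"
    by (simp add: complexification_def A_def B_def A'_def B'_def Let_def)
  have cZ: "?Z \<in> carrier_mat (n + n) (n + n)" and cW: "?W \<in> carrier_mat (n + n) (n + n)"
    and cJ: "?J \<in> carrier_mat (n + n) (n + n)" and cK: "?K \<in> carrier_mat (n + n) (n + n)"
    using c by auto
  have n1: "(- 1\<^sub>m n) * X = - X" "X * (- 1\<^sub>m n) = - X"
    if "X \<in> carrier_mat n n" for X :: "complex mat"
    using that by auto
  have "?J * ?Z = four_block_mat (- B) (- A') A (- B')"
    using c by (subst mult_four_block_mat[of _ n n _ n _ n _ _ n _ n]) (auto simp: n1)
  moreover have "?W * ?J = four_block_mat (- B) (- A') A (- B')"
    using c by (subst mult_four_block_mat[of _ n n _ n _ n _ _ n _ n]) (auto simp: n1)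
  ultimately have eq: "?W * ?J = ?J * ?Z" by simp
  have "?J * ?K = four_block_mat (1\<^sub>m n) (0\<^sub>m n n) (- 0\<^sub>m n n) (1\<^sub>m n)"
    by (subst mult_four_block_mat[of _ n n _ n _ n _ _ n _ n]) (auto simp: n1)
  also have "\<dots> = 1\<^sub>m (n + n)"
    by (rule eq_matI) auto
  finally have "?J * ?K = 1\<^sub>m (n + n)" .
  then have "det ?J * det ?K = 1"
    using det_mult[OF cJ cK] by simp
  then have J: "det ?J \<noteq> 0" by auto
  have "det ?W * det ?J = det ?J * det ?Z"
    by (metis eq det_mult[OF cW cJ] det_mult[OF cJ cZ])
  with J have "det ?W = det ?Z" by simp
  moreover have "?W = map_mat cnj ?Z"
    using c by (intro eq_matI) (auto simp: A'_def B'_def four_block_mat_def Let_def)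
  ultimately have "cnj (det ?Z) = det ?Z"
    using cnj.hom_det[of ?Z] by simp
  then show ?thesis by (simp add: Z Reals_cnj_iff)
qed

text \<open>
  By the previous lemma, taking the real part loses nothing. For a real number \<open>x < 0\<close> the library
  sets \<open>sqrt x = - sqrt (- x) < 0\<close>; hence \<open>Sdet M \<ge> 0\<close> holds exactly when the determinant is
  nonnegative, and then it is the square root of the determinant.
\<close>

definition Sdet :: "quat mat \<Rightarrow> real" where
  "Sdet M = sqrt (Re (det (complexification M)))"

end

(* The complexification Z is multiplicative and det (Z M) is real, so det (Z M) is a square of a
   real number, hence nonnegative, whenever M is a product of squares. Gaussian elimination shows
   that every quaternionic matrix is such a product: a block transvection is the square of the
   transvection with half the entries, and every quaternion has a square root. For unitary U,
   Z U is unitary, so the nonnegative number det (Z U) is 1; the SVD then leaves only the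
   determinant of the diagonal factor, the square of the product of the singular values. *)
theory Submission
  imports Defs
begin

section \<open>Factorization of quaternionic matrices into squares\<close>

inductive prod_of_squares :: "nat \<Rightarrow> 'a :: semiring_1 mat \<Rightarrow> bool" for n where
  square: "X \<in> carrier_mat n n \<Longrightarrow> prod_of_squares n (X * X)"
| mult: "prod_of_squares n X \<Longrightarrow> prod_of_squares n Y \<Longrightarrow> prod_of_squares n (X * Y)"

lemma prod_of_squares_carrier: "prod_of_squares n X \<Longrightarrow> X \<in> carrier_mat n n"
  by (induction rule: prod_of_squares.induct) auto

text \<open>From \<open>q * q = 2 Re(q) q - m^2\<close> with \<open>m = |q|\<close> follows
  \<open>(q + m)^2 = 2 (m + Re q) q\<close>. Rescaling \<open>q + m\<close> gives a root unless the
  real factor \<open>m + Re q\<close> vanishes.\<close>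

lemma quat_square_root: "\<exists>s :: quat. s * s = q"
proof -
  define m where "m = sqrt ((qRe q)\<^sup>2 + (qI q)\<^sup>2 + (qJ q)\<^sup>2 + (qK q)\<^sup>2)"
  have m2: "m * m = (qRe q)\<^sup>2 + (qI q)\<^sup>2 + (qJ q)\<^sup>2 + (qK q)\<^sup>2"
    by (simp add: m_def)
  have "\<bar>qRe q\<bar> \<le> m"
    unfolding m_def by (rule real_le_rsqrt) simp
  then consider "m + qRe q = 0" | "m + qRe q > 0" by linarith
  then show ?thesis
  proof cases
    case 1
    then have m: "m = - qRe q" by simp
    \<comment> \<open>Here \<open>m = - qRe q\<close> leaves no room for an imaginary part:
      \<open>q\<close> is a real number at most 0, and a real multiple of i is a root.\<close>
    have "(qI q)\<^sup>2 + (qJ q)\<^sup>2 + (qK q)\<^sup>2 = 0"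
      using m2 unfolding m by (simp add: power2_eq_square)
    then have "qI q = 0" "qJ q = 0" "qK q = 0"
      by (auto simp: add_nonneg_eq_0_iff)
    moreover have "qRe q \<le> 0" using m \<open>\<bar>qRe q\<bar> \<le> m\<close> by simp
    ultimately have "Quat 0 (sqrt (- qRe q)) 0 0 * Quat 0 (sqrt (- qRe q)) 0 0 = q"
      by (simp add: quat_eq_iff)
    then show ?thesis by blast
  next
    case 2
    define r where "r = sqrt (2 * (m + qRe q))"
    have r: "r * r = 2 * (m + qRe q)" "r \<noteq> 0" using 2 by (auto simp: r_def)
    have "(q + of_real m) * (q + of_real m) = (r * r) *\<^sub>R q"
      unfolding r(1) using m2
      by (auto simp: quat_eq_iff of_real_quat algebra_simps power2_eq_square)
    then have "((1 / r) *\<^sub>R (q + of_real m)) * ((1 / r) *\<^sub>R (q + of_real m)) = q"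
      using r(2) by simp
    then show ?thesis by blast
  qed
qed

abbreviation block_diag :: "'a :: zero mat \<Rightarrow> 'a mat \<Rightarrow> 'a mat" where
  "block_diag A D \<equiv> four_block_mat A (0\<^sub>m (dim_row A) (dim_col D)) (0\<^sub>m (dim_row D) (dim_col A)) D"

lemma block_diag_mult:
  fixes A B C D :: "'a :: semiring_1 mat"
  assumes "A \<in> carrier_mat m m" "B \<in> carrier_mat m m" "C \<in> carrier_mat n n" "D \<in> carrier_mat n n"
  shows "block_diag A C * block_diag B D = block_diag (A * B) (C * D)"
  using assms by (subst mult_four_block_mat[of _ m m _ n _ n _ _ m _ n]) auto

text \<open>Padding with an identity block is multiplicative, so it maps squares to squares. This
  lifts the induction hypothesis on smaller matrices to the full size.\<close>

lemma prod_of_squares_block_diag: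
  fixes D :: "'a :: semiring_1 mat"
  assumes "prod_of_squares n D"
  shows "prod_of_squares (m + n) (block_diag (1\<^sub>m m) D)"
  using assms
proof induction
  case (square X)
  have "block_diag (1\<^sub>m m) (X * X) = block_diag (1\<^sub>m m) X * block_diag (1\<^sub>m m) X"
    using square block_diag_mult[of "1\<^sub>m m" m "1\<^sub>m m" X n X] by simp
  then show ?case using square by (metis prod_of_squares.square four_block_carrier_mat one_carrier_mat)
next
  case (mult X Y)
  have "block_diag (1\<^sub>m m) (X * Y) = block_diag (1\<^sub>m m) X * block_diag (1\<^sub>m m) Y"
    using mult.hyps[THEN prod_of_squares_carrier] block_diag_mult[of "1\<^sub>m m" m "1\<^sub>m m" X n Y] by simp
  then show ?case using mult.IH by (metis prod_of_squares.mult)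
qed

lemma quat_mat_half:
  fixes B :: "quat mat"
  assumes "B \<in> carrier_mat m n"
  obtains H where "H \<in> carrier_mat m n" "H + H = B"
proof
  show "map_mat ((*\<^sub>R) (1/2)) B \<in> carrier_mat m n" using assms by simp
  show "map_mat ((*\<^sub>R) (1/2)) B + map_mat ((*\<^sub>R) (1/2)) B = B"
    by (intro eq_matI) (auto simp: quat_eq_iff)
qed

text \<open>Multiplying two such unitriangular block matrices adds their off-diagonal blocks, so
  halving the block gives a root.\<close>

lemma prod_of_squares_upper:
  fixes B :: "quat mat"
  assumes "B \<in> carrier_mat m n"
  shows "prod_of_squares (m + n) (four_block_mat (1\<^sub>m m) B (0\<^sub>m n m) (1\<^sub>m n))"
proof -
  obtain H where H: "H \<in> carrier_mat m n" "H + H = B" using quat_mat_half[OF assms] .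
  let ?X = "four_block_mat (1\<^sub>m m) H (0\<^sub>m n m) (1\<^sub>m n)"
  have "?X * ?X = four_block_mat (1\<^sub>m m) B (0\<^sub>m n m) (1\<^sub>m n)"
    using H by (subst mult_four_block_mat[of _ m m _ n _ n _ _ m _ n]) auto
  then show ?thesis
    using square[of ?X "m + n"] four_block_carrier_mat[of "1\<^sub>m m" m m "1\<^sub>m n" n n] by simp
qed

lemma prod_of_squares_lower:
  fixes C :: "quat mat"
  assumes "C \<in> carrier_mat n m"
  shows "prod_of_squares (m + n) (four_block_mat (1\<^sub>m m) (0\<^sub>m m n) C (1\<^sub>m n))"
proof -
  obtain H where H: "H \<in> carrier_mat n m" "H + H = C" using quat_mat_half[OF assms] .
  let ?X = "four_block_mat (1\<^sub>m m) (0\<^sub>m m n) H (1\<^sub>m n)"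
  have "?X * ?X = four_block_mat (1\<^sub>m m) (0\<^sub>m m n) C (1\<^sub>m n)"
    using H by (subst mult_four_block_mat[of _ m m _ n _ n _ _ m _ n]) auto
  then show ?thesis
    using square[of ?X "m + n"] four_block_carrier_mat[of "1\<^sub>m m" m m "1\<^sub>m n" n n] by simp
qed

text \<open>Square roots of quaternions enter only here. The entry of \<open>A\<close> may be zero,
  which lets singular matrices be factored as well.\<close>

lemma prod_of_squares_corner:
  fixes A :: "quat mat"
  assumes A: "A \<in> carrier_mat 1 1"
  shows "prod_of_squares (1 + n) (block_diag A (1\<^sub>m n))"
proof -
  obtain s where s: "s * s = A $$ (0, 0)" using quat_square_root by blast
  define S where "S = mat 1 1 (\<lambda>_. s)"
  have S: "S \<in> carrier_mat 1 1" by (simp add: S_def)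
  have "S * S = A" using A s by (intro eq_matI) (auto simp: S_def scalar_prod_def)
  then have "block_diag S (1\<^sub>m n) * block_diag S (1\<^sub>m n) = block_diag A (1\<^sub>m n)"
    using block_diag_mult[OF S S, of "1\<^sub>m n" n "1\<^sub>m n"] by simp
  moreover have "block_diag S (1\<^sub>m n) \<in> carrier_mat (1 + n) (1 + n)"
    using S by (metis four_block_carrier_mat one_carrier_mat)
  ultimately show ?thesis by (metis square)
qed

text \<open>One step of block elimination: an invertible corner \<open>A\<close> splits the matrix
  into lower unitriangular, block diagonal and upper unitriangular factors.\<close>

lemma prod_of_squares_pivot:
  fixes A B C D :: "quat mat"
  assumes A: "A \<in> carrier_mat 1 1" "A $$ (0, 0) \<noteq> 0" and B: "B \<in> carrier_mat 1 n"
    and C: "C \<in> carrier_mat n 1" and D: "D \<in> carrier_mat n n"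
    and IH: "\<And>X :: quat mat. X \<in> carrier_mat n n \<Longrightarrow> prod_of_squares n X"
  shows "prod_of_squares (1 + n) (four_block_mat A B C D)"
proof -
  define A' where "A' = mat 1 1 (\<lambda>_. inverse (A $$ (0, 0)))"
  have A': "A' \<in> carrier_mat 1 1" by (simp add: A'_def)
  have inv: "A * A' = 1\<^sub>m 1" "A' * A = 1\<^sub>m 1"
    using A by (auto intro!: eq_matI simp: A'_def scalar_prod_def)
  \<comment> \<open>The Schur complement of \<open>A\<close>, with the factors in the order that
    noncommuting entries require.\<close>
  define S where "S = D - C * A' * B"
  have S: "S \<in> carrier_mat n n" using A' B C D by (simp add: S_def minus_carrier_mat)
  let ?L = "four_block_mat (1\<^sub>m 1) (0\<^sub>m 1 n) (C * A') (1\<^sub>m n)"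
  let ?R = "four_block_mat (1\<^sub>m 1) (A' * B) (0\<^sub>m n 1) (1\<^sub>m n)"
  let ?A = "block_diag A (1\<^sub>m n)" and ?S = "block_diag (1\<^sub>m 1) S"
  \<comment> \<open>The diagonal factor is split so that the corner lemma handles \<open>A\<close>
    and the hypothesis \<open>IH\<close> handles \<open>S\<close>.\<close>
  have AS: "?A * ?S = block_diag A S"
    using block_diag_mult[OF A(1), of "1\<^sub>m 1" "1\<^sub>m n" n S] A S by simp
  have 1: "C * A' * A = C" using A A' C inv by (simp add: assoc_mult_mat[of _ n 1 _ 1])
  have 2: "A * (A' * B) = B" using A A' B inv by (simp flip: assoc_mult_mat[of _ 1 1 _ 1])
  have 3: "C * (A' * B) + S = D"
    using A' B C D by (intro eq_matI) (auto simp: S_def assoc_mult_mat[of _ n 1 _ 1 _ n])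
  have LA: "?L * block_diag A S = four_block_mat A (0\<^sub>m 1 n) C S"
    using A A' C S 1 by (subst mult_four_block_mat[of _ 1 1 _ n _ n _ _ 1 _ n]) auto
  have LAR: "four_block_mat A (0\<^sub>m 1 n) C S * ?R = four_block_mat A B C D"
    using A A' B C S 2 3 by (subst mult_four_block_mat[of _ 1 1 _ n _ n _ _ 1 _ n]) auto
  have "prod_of_squares (1 + n) (?L * (?A * ?S) * ?R)"
    using A' B C S IH
    by (intro mult prod_of_squares_lower prod_of_squares_upper prod_of_squares_corner
        prod_of_squares_block_diag A(1)) auto
  then show ?thesis unfolding AS LA LAR .
qed

text \<open>Induction on the size. Either adding a combination of the lower rows to the first row
  produces a nonzero pivot, or the first column is zero.\<close>

lemma prod_of_squares_quat_mat:
  fixes M :: "quat mat"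
  assumes "M \<in> carrier_mat n n"
  shows "prod_of_squares n M"
  using assms
proof (induction n arbitrary: M)
  case 0
  \<comment> \<open>There is only one matrix of size 0, so it is its own square.\<close>
  then have "M = M * M" by (intro eq_matI) auto
  then show ?case using square[OF 0] by metis
next
  case (Suc n)
  obtain A B C D where split: "split_block M 1 1 = (A, B, C, D)" by (metis prod_cases4)
  from split_block[OF this, of n n] Suc.prems
  have A: "A \<in> carrier_mat 1 1" and B: "B \<in> carrier_mat 1 n" and C: "C \<in> carrier_mat n 1"
    and D: "D \<in> carrier_mat n n" and M: "M = four_block_mat A B C D" by auto
  show ?case
  proof (cases "\<exists>E \<in> carrier_mat 1 n. (A + E * C) $$ (0, 0) \<noteq> 0")
    case True
    then obtain E where E: "E \<in> carrier_mat 1 n" "(A + E * C) $$ (0, 0) \<noteq> 0" by blast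
    let ?N = "four_block_mat (A + E * C) (B + E * D) C D"
    \<comment> \<open>\<open>?T\<close> undoes the row operation that led from \<open>M\<close> to
      \<open>?N\<close>, whose corner is a nonzero pivot.\<close>
    let ?T = "four_block_mat (1\<^sub>m 1) (- E) (0\<^sub>m n 1) (1\<^sub>m n)"
    have 1: "A + E * C + - E * C = A" "B + E * D + - E * D = B"
      using A B C D E by (auto intro!: eq_matI)
    have "?T * ?N = M"
      unfolding M using A B C D E 1 by (subst mult_four_block_mat[of _ 1 1 _ n _ n _ _ 1 _ n]) auto
    moreover have "prod_of_squares (1 + n) (?T * ?N)"
      using A B C D E Suc.IH
      by (intro mult prod_of_squares_upper prod_of_squares_pivot) auto
    ultimately show ?thesis by simp
  next
    case False
    then have z: "(A + E * C) $$ (0, 0) = 0" if "E \<in> carrier_mat 1 n" for E using that by blast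
    have "A = 0\<^sub>m 1 1" using z[of "0\<^sub>m 1 n"] A C by (intro eq_matI) auto
    moreover have "C = 0\<^sub>m n 1"
    proof (rule eq_matI)
      fix i j assume "i < dim_row (0\<^sub>m n 1 :: quat mat)" "j < dim_col (0\<^sub>m n 1 :: quat mat)"
      then have ij: "i < n" "j = 0" by auto
      \<comment> \<open>The unit row vector at position \<open>i\<close> picks the entry of
        \<open>C\<close> in row \<open>i\<close>, which must then vanish because \<open>A\<close> is
        zero.\<close>
      define E :: "quat mat" where "E = mat 1 n (\<lambda>(_, k). if k = i then 1 else 0)"
      have "row E 0 \<bullet> col C 0 = (\<Sum>k<n. if k = i then C $$ (k, 0) else 0)"
        using C by (auto simp: E_def scalar_prod_def atLeast0LessThan simp del: sum.delta
            intro!: sum.cong)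
      then have "(A + E * C) $$ (0, 0) = C $$ (i, 0)"
        using \<open>A = 0\<^sub>m 1 1\<close> C ij by (simp add: E_def)
      then show "C $$ (i, j) = 0\<^sub>m n 1 $$ (i, j)" using z[of E] ij by (simp add: E_def)
    qed (use C in auto)
    \<comment> \<open>The last factor erases the first column, so the corner of the other two can be
      taken to be 1.\<close>
    moreover have "four_block_mat (0\<^sub>m 1 1) B (0\<^sub>m n 1) D =
        block_diag (1\<^sub>m 1) D * four_block_mat (1\<^sub>m 1) B (0\<^sub>m n 1) (1\<^sub>m n) * block_diag (0\<^sub>m 1 1) (1\<^sub>m n)"
      using B D by (simp add: mult_four_block_mat[of _ 1 1 _ n _ n _ _ 1 _ n])
    moreover have "prod_of_squares (1 + n) (block_diag (1\<^sub>m 1) D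
        * four_block_mat (1\<^sub>m 1) B (0\<^sub>m n 1) (1\<^sub>m n) * block_diag (0\<^sub>m 1 1) (1\<^sub>m n))"
      using B D Suc.IH
      by (intro mult prod_of_squares_upper prod_of_squares_block_diag prod_of_squares_corner) auto
    ultimately show ?thesis using M by simp
  qed
qed

section \<open>Complexification respects products, identity and adjoints\<close>

lemma complexification_carrier:
  "M \<in> carrier_mat n m \<Longrightarrow> complexification M \<in> carrier_mat (n + n) (m + m)"
  by (auto simp: complexification_def Let_def)

lemma qcomp_add: "qcomp1 (x + y) = qcomp1 x + qcomp1 y" "qcomp2 (x + y) = qcomp2 x + qcomp2 y"
  by (auto simp: qcomp1_def qcomp2_def complex_eq_iff)

lemma qcomp_0: "qcomp1 0 = 0" "qcomp2 0 = 0"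
  by (auto simp: qcomp1_def qcomp2_def complex_eq_iff)

lemma qcomp_sum: "qcomp1 (sum f S) = (\<Sum>i\<in>S. qcomp1 (f i))" "qcomp2 (sum f S) = (\<Sum>i\<in>S. qcomp2 (f i))"
  by (induction S rule: infinite_finite_induct) (auto simp: qcomp_add qcomp_0)

text \<open>Expand \<open>(x1 + j x2) (y1 + j y2)\<close> and move j to the left by
  \<open>z j = j (cnj z)\<close> for complex z; the minus sign is \<open>j j = -1\<close>.\<close>

lemma qcomp_mult:
  "qcomp1 (x * y) = qcomp1 x * qcomp1 y - cnj (qcomp2 x) * qcomp2 y"
  "qcomp2 (x * y) = qcomp2 x * qcomp1 y + cnj (qcomp1 x) * qcomp2 y"
  by (auto simp: qcomp1_def qcomp2_def complex_eq_iff)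

lemma complexification_mult:
  assumes M: "M \<in> carrier_mat n m" and N: "N \<in> carrier_mat m l"
  shows "complexification (M * N) = complexification M * complexification N"
proof -
  have 1: "map_mat qcomp1 (M * N) = map_mat qcomp1 M * map_mat qcomp1 N
      + - map_mat cnj (map_mat qcomp2 M) * map_mat qcomp2 N"
    using M N by (intro eq_matI)
      (auto simp: scalar_prod_def qcomp_sum qcomp_mult sum_subtractf sum_negf)
  have 2: "map_mat qcomp2 (M * N) = map_mat qcomp2 M * map_mat qcomp1 N
      + map_mat cnj (map_mat qcomp1 M) * map_mat qcomp2 N"
    using M N by (intro eq_matI) (auto simp: scalar_prod_def qcomp_sum qcomp_mult sum.distrib)
  \<comment> \<open>The right block column: \<open>3\<close> and \<open>4\<close> are the conjugates
    of \<open>2\<close> and \<open>1\<close>, up to the sign in \<open>3\<close>.\<close>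
  have 3: "- map_mat cnj (map_mat qcomp2 (M * N)) =
      map_mat qcomp1 M * - map_mat cnj (map_mat qcomp2 N)
      + - map_mat cnj (map_mat qcomp2 M) * map_mat cnj (map_mat qcomp1 N)"
    using M N by (intro eq_matI)
      (auto simp: scalar_prod_def qcomp_sum qcomp_mult sum.distrib sum_negf sum_subtractf)
  have 4: "map_mat cnj (map_mat qcomp1 (M * N)) =
      map_mat qcomp2 M * - map_mat cnj (map_mat qcomp2 N)
      + map_mat cnj (map_mat qcomp1 M) * map_mat cnj (map_mat qcomp1 N)"
    using M N by (intro eq_matI)
      (auto simp: scalar_prod_def qcomp_sum qcomp_mult sum.distrib sum_negf sum_subtractf)
  show ?thesis
    unfolding complexification_def Let_def 3 4 unfolding 1 2 using M N
    by (subst mult_four_block_mat[of _ n m _ m _ n _ _ l _ l]) auto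
qed

lemma complexification_one: "complexification (1\<^sub>m n) = 1\<^sub>m (n + n)"
  unfolding complexification_def Let_def
  by (intro eq_matI) (auto simp: qcomp1_def qcomp2_def complex_eq_iff)

text \<open>Quaternion conjugation sends the components \<open>(z1, z2)\<close> to
  \<open>(cnj z1, - z2)\<close>. Transposition moves the sign to the other off-diagonal
  block.\<close>

lemma complexification_qadjoint:
  "M \<in> carrier_mat n n \<Longrightarrow>
    complexification (qadjoint M) = transpose_mat (map_mat cnj (complexification M))"
  unfolding complexification_def Let_def
  by (intro eq_matI) (auto simp: qadjoint_def qcnj_def qcomp1_def qcomp2_def complex_eq_iff)

section \<open>The determinant of the complexification\<close>

lemma det_complexification_mult:
  assumes "M \<in> carrier_mat n n" "N \<in> carrier_mat n n"
  shows "det (complexification (M * N)) = det (complexification M) * det (complexification N)"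
  using assms
  by (simp add: complexification_mult det_mult[OF complexification_carrier complexification_carrier])

text \<open>The order on complex numbers relates only numbers with equal imaginary part, so the
  bound includes that the determinant is real.\<close>

lemma det_complexification_nonneg:
  assumes "M \<in> carrier_mat n n"
  shows "det (complexification M) \<ge> 0"
  using prod_of_squares_quat_mat[OF assms]
proof induction
  case (square X)
  then obtain r where "det (complexification X) = of_real r"
    using det_complexification_real by (metis Reals_cases)
  then show ?case using square by (simp add: det_complexification_mult less_eq_complex_def)
next
  case (mult X Y)
  then show ?case
    using mult.hyps[THEN prod_of_squares_carrier]
    by (simp add: det_complexification_mult less_eq_complex_def)
qed

text \<open>Unitarity gives modulus 1, reality leaves 1 and -1, and nonnegativity excludes
  -1.\<close>

lemma det_complexification_qunitary:
  assumes "qunitary n U"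
  shows "det (complexification U) = 1"
proof -
  interpret cnj: comm_ring_hom cnj
    by unfold_locales auto
  let ?d = "det (complexification U)"
  have U: "U \<in> carrier_mat n n" "qadjoint U * U = 1\<^sub>m n"
    using assms by (auto simp: qunitary_def)
  obtain r where r: "?d = of_real r"
    using det_complexification_real[OF U(1)] by (auto elim: Reals_cases)
  have aU: "qadjoint U \<in> carrier_mat n n" using U by (auto simp: qadjoint_def)
  have "det (complexification (qadjoint U)) = cnj ?d"
    using U(1) complexification_carrier[OF U(1)]
    by (simp add: complexification_qadjoint det_transpose[of _ "n + n"] cnj.hom_det)
  then have "cnj ?d * ?d = 1"
    using det_complexification_mult[OF aU U(1)] U(2) by (simp add: complexification_one)
  then have "r * r = 1" unfolding r by (simp add: complex_eq_iff)
  moreover have "r \<ge> 0" using det_complexification_nonneg[OF U(1)] r by (simp add: less_eq_complex_def)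
  ultimately have "r = 1" by (metis abs_of_nonneg abs_1 square_eq_1_iff abs_minus)
  then show ?thesis using r by simp
qed

text \<open>Real entries have second component 0, so the complexification consists of two diagonal
  copies of the same matrix; hence the square.\<close>

lemma det_complexification_real_diag:
  "det (complexification (real_diag_mat n \<sigma>)) = of_real ((\<Prod>i<n. \<sigma> i)\<^sup>2)"
proof -
  let ?D = "mat n n (\<lambda>(i, j). if i = j then of_real (\<sigma> i) else 0) :: complex mat"
  have D: "?D \<in> carrier_mat n n" by simp
  have "complexification (real_diag_mat n \<sigma>) = four_block_mat ?D (0\<^sub>m n n) (0\<^sub>m n n) ?D"
    unfolding complexification_def Let_def
    by (intro eq_matI) (auto simp: real_diag_mat_def of_real_quat qcomp1_def qcomp2_def complex_eq_iff)
  then have "det (complexification (real_diag_mat n \<sigma>)) = det ?D * det ?D"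
    using det_four_block_mat_lower_left_zero[OF D zero_carrier_mat refl D] by simp
  also have "det ?D = (\<Prod>i<n. of_real (\<sigma> i))"
    by (subst det_upper_triangular[of _ n])
      (auto simp: diag_mat_def prod.list_conv_set_nth atLeast0LessThan)
  finally show ?thesis by (simp add: power2_eq_square)
qed

theorem corollary6p5:
  fixes n :: nat and M :: "quat mat" and \<sigma> :: "nat \<Rightarrow> real"
  assumes "M \<in> carrier_mat n n"
    and "is_singular_values n M \<sigma>"
  shows "Sdet M = (\<Prod>i<n. \<sigma> i)"
proof -
  obtain U V where UV: "qunitary n U" "qunitary n V" and M: "M = U * real_diag_mat n \<sigma> * V"
    and nonneg: "\<forall>i<n. 0 \<le> \<sigma> i"
    using assms(2) by (auto simp: is_singular_values_def)
  have "U \<in> carrier_mat n n" "V \<in> carrier_mat n n" "real_diag_mat n \<sigma> \<in> carrier_mat n n"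
    using UV by (auto simp: qunitary_def real_diag_mat_def)
  then have "det (complexification M) = of_real ((\<Prod>i<n. \<sigma> i)\<^sup>2)"
    using UV unfolding M
    by (simp add: det_complexification_mult[of _ n] det_complexification_qunitary
        det_complexification_real_diag)
  \<comment> \<open>The root of a square is an absolute value, removed next since all
    \<open>\<sigma> i\<close> with \<open>i < n\<close> are nonnegative.\<close>
  then have "Sdet M = \<bar>\<Prod>i<n. \<sigma> i\<bar>" by (simp add: Sdet_def flip: of_real_power)
  also have "\<dots> = (\<Prod>i<n. \<sigma> i)" using nonneg by (intro abs_of_nonneg prod_nonneg) auto
  finally show ?thesis .
qed

end
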